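(* Let $0<\lambda_0<\lambda_1<\cdots$ be a real sequence with $\lambda_n\to\infty$ such that $\sum_{n}\frac1{\lambda_n}$ diverges. Let $(u_n)_{n\ge 0}$ be a sequence of fuzzy numbers and let $\mu$ be a fuzzy number. Suppose that $\sum u_n$ is summable to $\mu$ by generalized factorial series, i.e. the series $\sum_{n=0}^\infty \frac{u_n\lambda_0\cdots\lambda_n}{(s+\lambda_0)\cdots(s+\lambda_n)}$ converges for every $s>0$ and $$\lim_{s\to0^+}\sum_{n=0}^\infty \frac{u_n\lambda_0\cdots\lambda_n}{(s+\lambda_0)\cdots(s+\lambda_n)}=\mu.$$ If $$\lambda_n\left(\sum_{r=0}^{n}\frac{1}{\lambda_r}\right)D(u_n,\bar{0})=o(1)\qquad(n\to\infty),$$ then $\sum_{n=0}^\infty u_n=\mu$.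
   Context: A fuzzy number is a function $u:\mathbb{R}\to[0,1]$ that is normal ($u(t_0)=1$ for some $t_0$), fuzzy convex ($u(\theta t+(1-\theta)t')\ge\min\{u(t),u(t')\}$ for all $t,t'\in\mathbb{R}$, $\theta\in[0,1]$), upper semicontinuous, and has compact support $\overline{\{t\in\mathbb{R}:u(t)>0\}}$. $\mathbb{R}_{\mathcal{F}}$ denotes the set of fuzzy numbers. The $\alpha$-level sets are $[u]_\alpha=\{t:u(t)\ge\alpha\}$ for $0<\alpha\le1$ and $[u]_0=\overline{\{t:u(t)>0\}}$; they are compact intervals, written $[u]_\alpha=[u^-_\alpha,u^+_\alpha]$. The fuzzy number $\bar 0$ is given by $\bar0(0)=1$ and $\bar0(t)=0$ for $t\ne0$. Operations are levelwise: $[u+v]_\alpha=[u^-_\alpha+v^-_\alpha,u^+_\alpha+v^+_\alpha]$, and for $k\in\mathbb{R}$, $[ku]_\alpha=[ku^-_\alpha,ku^+_\alpha]$ if $k\ge0$ and $[ku]_\alpha=[ku^+_\alpha,ku^-_\alpha]$ if $k<0$. The expression $u_nc$ with $c\in\mathbb{R}$ means the scalar multiple $cu_n$. The metric on $\mathbb{R}_{\mathcal{F}}$ is $D(u,v)=\sup_{\alpha\in[0,1]}\max\{|u^-_\alpha-v^-_\alpha|,|u^+_\alpha-v^+_\alpha|\}$. All limits of fuzzy numbers are with respect to $D$. A series $\sum u_n$ of fuzzy numbers converges to $u\in\mathbb{R}_{\mathcal{F}}$ (written $\sum u_n=u$) if its partial sums converge to $u$ in $D$. *)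

theory Defs
  imports "HOL-Analysis.Analysis" "HOL-Library.Landau_Symbols"
begin

definition upper_semicontinuous :: "(real \<Rightarrow> real) \<Rightarrow> bool" where
  "upper_semicontinuous u \<longleftrightarrow> (\<forall>t y. u t < y \<longrightarrow> (\<forall>\<^sub>F x in nhds t. u x < y))"

definition fuzzy_number :: "(real \<Rightarrow> real) \<Rightarrow> bool" where
  "fuzzy_number u \<longleftrightarrow>
     (\<forall>t. 0 \<le> u t \<and> u t \<le> 1) \<and>
     (\<exists>t0. u t0 = 1) \<and>
     (\<forall>t t' \<theta>. 0 \<le> \<theta> \<and> \<theta> \<le> 1 \<longrightarrow> min (u t) (u t') \<le> u (\<theta> * t + (1 - \<theta>) * t')) \<and>
     upper_semicontinuous u \<and>
     compact (closure {t. 0 < u t})"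

lemma fuzzy_number_indicator: "fuzzy_number (\<lambda>t. if t = c then 1 else 0)"
proof -
  have "upper_semicontinuous (\<lambda>t. if t = c then 1 else 0)"
    unfolding upper_semicontinuous_def
  proof (intro allI impI)
    fix t y :: real
    assume y: "(if t = c then 1 else 0) < y"
    show "\<forall>\<^sub>F x in nhds t. (if x = c then 1 else 0) < y"
    proof (cases "t = c")
      case True
      with y have "\<And>x. (if x = c then 1 else 0) < y" by auto
      then show ?thesis by simp
    next
      case False
      then have "\<forall>\<^sub>F x in nhds t. x \<noteq> c" by (rule t1_space_nhds)
      then show ?thesis by eventually_elim (use y False in auto)
    qed
  qed
  moreover have "min (if t = c then 1 else 0) (if t' = c then 1 else 0)
      \<le> (if \<theta> * t + (1 - \<theta>) * t' = c then 1 else (0::real))" for t t' \<theta>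
  proof (cases "t = c \<and> t' = c")
    case True
    then have "\<theta> * t + (1 - \<theta>) * t' = c" by (simp add: left_diff_distrib)
    then show ?thesis by simp
  qed auto
  ultimately show ?thesis unfolding fuzzy_number_def by auto
qed

typedef fuzzy = "{u. fuzzy_number u}" morphisms membership Abs_fuzzy
  using fuzzy_number_indicator by blast

definition level :: "fuzzy \<Rightarrow> real \<Rightarrow> real set" where
  "level u \<alpha> = (if \<alpha> = 0 then closure {t. 0 < membership u t} else {t. \<alpha> \<le> membership u t})"

definition lower_end :: "fuzzy \<Rightarrow> real \<Rightarrow> real" where
  "lower_end u \<alpha> = Inf (level u \<alpha>)"

definition upper_end :: "fuzzy \<Rightarrow> real \<Rightarrow> real" where
  "upper_end u \<alpha> = Sup (level u \<alpha>)"

lemma fuzzy_number_membership: "fuzzy_number (membership u)"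
  using membership by blast

lemma membership_le_1: "membership u t \<le> 1"
  using fuzzy_number_membership[of u] by (auto simp: fuzzy_number_def)

lemma membership_nonneg: "0 \<le> membership u t"
  using fuzzy_number_membership[of u] by (auto simp: fuzzy_number_def)

lemma level_antimono:
  assumes "0 \<le> \<alpha>" "\<alpha> \<le> \<beta>"
  shows "level u \<beta> \<subseteq> level u \<alpha>"
proof (cases "\<alpha> = 0 \<and> \<beta> \<noteq> 0")
  case True
  then have "level u \<beta> \<subseteq> {t. 0 < membership u t}" using assms by (auto simp: level_def)
  then show ?thesis using True closure_subset by (auto simp: level_def)
next
  case False
  then show ?thesis using assms by (auto simp: level_def)
qed

lemma level_nonempty:
  assumes "\<alpha> \<in> {0..1}" shows "level u \<alpha> \<noteq> {}"
proof -
  obtain t0 where "membership u t0 = 1"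
    using fuzzy_number_membership[of u] by (auto simp: fuzzy_number_def)
  then have "t0 \<in> level u 1" by (simp add: level_def)
  then show ?thesis using level_antimono[of \<alpha> 1 u] assms by auto
qed

lemma compact_level:
  assumes "\<alpha> \<in> {0..1}" shows "compact (level u \<alpha>)"
proof (cases "\<alpha> = 0")
  case True
  then show ?thesis using fuzzy_number_membership[of u] by (simp add: level_def fuzzy_number_def)
next
  case False
  have "open {t. membership u t < \<alpha>}"
  proof (subst open_subopen, intro ballI)
    fix t assume "t \<in> {t. membership u t < \<alpha>}"
    then have "\<forall>\<^sub>F x in nhds t. membership u x < \<alpha>"
      using fuzzy_number_membership[of u] by (simp add: fuzzy_number_def upper_semicontinuous_def)
    then show "\<exists>T. open T \<and> t \<in> T \<and> T \<subseteq> {t. membership u t < \<alpha>}"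
      by (auto simp: eventually_nhds)
  qed
  then have "closed (level u \<alpha>)"
    using False by (simp add: level_def closed_def Compl_eq not_le)
  moreover have "compact (level u 0)"
    using fuzzy_number_membership[of u] by (simp add: level_def fuzzy_number_def)
  ultimately show ?thesis
    using level_antimono[of 0 \<alpha> u] assms compact_Int_closed[of "level u 0" "level u \<alpha>"]
    by (auto simp: Int_absorb1)
qed

lemma convex_level:
  assumes "\<alpha> \<in> {0..1}" shows "convex (level u \<alpha>)"
proof -
  have q: "min (membership u x) (membership u y) \<le> membership u (a * x + b * y)"
    if "0 \<le> a" "0 \<le> b" "a + b = 1" for a b x y
  proof -
    have "min (membership u x) (membership u y) \<le> membership u (a * x + (1 - a) * y)"
      using fuzzy_number_membership[of u] that unfolding fuzzy_number_def by auto
    moreover have "1 - a = b" using that by simp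
    ultimately show ?thesis by simp
  qed
  show ?thesis
  proof (cases "\<alpha> = 0")
    case True
    have "convex {t. 0 < membership u t}"
    proof (rule convexI)
      fix x y a b :: real
      assume "x \<in> {t. 0 < membership u t}" "y \<in> {t. 0 < membership u t}" "0 \<le> a" "0 \<le> b" "a + b = 1"
      then show "a *\<^sub>R x + b *\<^sub>R y \<in> {t. 0 < membership u t}"
        using q[of a b x y] by (simp add: min_def split: if_splits)
    qed
    then show ?thesis using True by (simp add: level_def convex_closure)
  next
    case False
    have "convex {t. \<alpha> \<le> membership u t}"
    proof (rule convexI)
      fix x y a b :: real
      assume "x \<in> {t. \<alpha> \<le> membership u t}" "y \<in> {t. \<alpha> \<le> membership u t}" "0 \<le> a" "0 \<le> b" "a + b = 1"
      then show "a *\<^sub>R x + b *\<^sub>R y \<in> {t. \<alpha> \<le> membership u t}"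
        using q[of a b x y] by (simp add: min_def split: if_splits)
    qed
    then show ?thesis using False by (simp add: level_def)
  qed
qed

lemma level_eq_interval:
  assumes "\<alpha> \<in> {0..1}"
  shows "level u \<alpha> = {lower_end u \<alpha>..upper_end u \<alpha>}"
proof -
  note L = compact_level[OF assms, of u] convex_level[OF assms, of u] level_nonempty[OF assms, of u]
  have bd: "bdd_below (level u \<alpha>)" "bdd_above (level u \<alpha>)"
    using compact_imp_bounded[OF L(1)] bounded_imp_bdd_below bounded_imp_bdd_above by auto
  have "Inf (level u \<alpha>) \<in> level u \<alpha>" "Sup (level u \<alpha>) \<in> level u \<alpha>"
    using closed_contains_Inf closed_contains_Sup L bd compact_imp_closed by blast+
  moreover have "is_interval (level u \<alpha>)" using L(2) by (simp add: is_interval_convex_1)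
  ultimately have "{lower_end u \<alpha>..upper_end u \<alpha>} \<subseteq> level u \<alpha>"
    unfolding lower_end_def upper_end_def is_interval_1 by (meson atLeastAtMost_iff subsetI)
  moreover have "level u \<alpha> \<subseteq> {lower_end u \<alpha>..upper_end u \<alpha>}"
    unfolding lower_end_def upper_end_def using bd by (auto intro: cInf_lower cSup_upper)
  ultimately show ?thesis by blast
qed

lemma lower_le_upper: "\<alpha> \<in> {0..1} \<Longrightarrow> lower_end u \<alpha> \<le> upper_end u \<alpha>"
  using level_eq_interval[of \<alpha> u] level_nonempty[of \<alpha> u] by auto

lemma fuzzy_eqI_level:
  assumes "\<And>\<alpha>. \<alpha> \<in> {0..1} \<Longrightarrow> level u \<alpha> = level v \<alpha>"
  shows "u = v"
proof -
  have *: "membership u t \<le> membership v t"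
    if "\<And>\<alpha>. \<alpha> \<in> {0..1} \<Longrightarrow> level u \<alpha> = level v \<alpha>" for u v t
  proof (cases "membership u t = 0")
    case False
    then have "t \<in> level u (membership u t)" by (simp add: level_def)
    then have "t \<in> level v (membership u t)"
      using that membership_le_1 membership_nonneg by simp
    then show ?thesis using False by (simp add: level_def)
  qed (simp add: membership_nonneg)
  have "membership u = membership v"
    using *[of u v] *[of v u] assms by (intro ext antisym) auto
  then show ?thesis by (simp add: membership_inject)
qed

lemma fuzzy_eqI:
  assumes "\<And>\<alpha>. \<alpha> \<in> {0..1} \<Longrightarrow> lower_end u \<alpha> = lower_end v \<alpha>"
    and "\<And>\<alpha>. \<alpha> \<in> {0..1} \<Longrightarrow> upper_end u \<alpha> = upper_end v \<alpha>"
  shows "u = v"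
  using assms by (intro fuzzy_eqI_level) (simp add: level_eq_interval)

text \<open>The Goetschel--Voxman conditions, which characterise the pairs of endpoint functions of
  fuzzy numbers. They are only used to show that the levelwise operations below are well defined.\<close>

definition endpoint_functions :: "(real \<Rightarrow> real) \<Rightarrow> (real \<Rightarrow> real) \<Rightarrow> bool" where
  "endpoint_functions a b \<longleftrightarrow>
     a 1 \<le> b 1 \<and>
     (\<forall>\<alpha> \<beta>. 0 \<le> \<alpha> \<and> \<alpha> \<le> \<beta> \<and> \<beta> \<le> 1 \<longrightarrow> a \<alpha> \<le> a \<beta> \<and> b \<beta> \<le> b \<alpha>) \<and>
     (\<forall>\<alpha> e. 0 < \<alpha> \<and> \<alpha> \<le> 1 \<and> 0 < e \<longrightarrow> (\<exists>\<beta>. 0 < \<beta> \<and> \<beta> < \<alpha> \<and> a \<alpha> - e < a \<beta> \<and> b \<beta> < b \<alpha> + e)) \<and>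
     (\<forall>e>0. \<exists>\<alpha>. 0 < \<alpha> \<and> \<alpha> \<le> 1 \<and> a \<alpha> < a 0 + e \<and> b 0 - e < b \<alpha>)"

lemma ends_antimono:
  assumes "0 \<le> \<alpha>" "\<alpha> \<le> \<beta>" "\<beta> \<le> 1"
  shows "lower_end u \<alpha> \<le> lower_end u \<beta>" "upper_end u \<beta> \<le> upper_end u \<alpha>"
proof -
  have "{lower_end u \<beta>..upper_end u \<beta>} \<subseteq> {lower_end u \<alpha>..upper_end u \<alpha>}"
    using level_antimono[of \<alpha> \<beta> u] assms by (simp add: level_eq_interval)
  then show "lower_end u \<alpha> \<le> lower_end u \<beta>" "upper_end u \<beta> \<le> upper_end u \<alpha>"
    using lower_le_upper[of \<beta> u] assms by auto
qed

lemma endpoint_functions_ends: "endpoint_functions (lower_end u) (upper_end u)"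
proof -
  note mono = ends_antimono[of _ _ u]
  have left: "\<exists>\<beta>. 0 < \<beta> \<and> \<beta> < \<alpha> \<and> lower_end u \<alpha> - e < lower_end u \<beta> \<and> upper_end u \<beta> < upper_end u \<alpha> + e"
    if \<alpha>: "0 < \<alpha>" "\<alpha> \<le> 1" and e: "0 < e" for \<alpha> e
  proof -
    have notin: "\<exists>\<beta>. 0 < \<beta> \<and> \<beta> < \<alpha> \<and> t \<notin> level u \<beta>" if "t \<notin> level u \<alpha>" for t
    proof -
      have "membership u t < \<alpha>" using that \<alpha> by (simp add: level_def)
      then obtain \<beta> where "membership u t < \<beta>" "\<beta> < \<alpha>" using dense by blast
      then show ?thesis using membership_nonneg[of u t] by (intro exI[of _ \<beta>]) (auto simp: level_def)
    qed
    have lu: "lower_end u \<alpha> \<le> upper_end u \<alpha>" using \<alpha> by (simp add: lower_le_upper)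
    have "lower_end u \<alpha> - e \<notin> level u \<alpha>" "upper_end u \<alpha> + e \<notin> level u \<alpha>"
      using \<alpha> e by (simp_all add: level_eq_interval)
    then obtain \<beta> \<gamma> where \<beta>: "0 < \<beta>" "\<beta> < \<alpha>" "lower_end u \<alpha> - e \<notin> level u \<beta>"
      and \<gamma>: "0 < \<gamma>" "\<gamma> < \<alpha>" "upper_end u \<alpha> + e \<notin> level u \<gamma>"
      using notin by meson
    have "lower_end u \<alpha> - e < lower_end u \<beta>"
      using \<beta> \<alpha> e lu mono[of \<beta> \<alpha>] by (auto simp: level_eq_interval)
    moreover have "upper_end u \<gamma> < upper_end u \<alpha> + e"
      using \<gamma> \<alpha> e lu mono[of \<gamma> \<alpha>] by (auto simp: level_eq_interval)
    ultimately show ?thesis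
      using mono[of \<beta> "max \<beta> \<gamma>"] mono[of \<gamma> "max \<beta> \<gamma>"] \<beta> \<gamma> \<alpha>
      by (intro exI[of _ "max \<beta> \<gamma>"]) auto
  qed
  have right: "\<exists>\<alpha>. 0 < \<alpha> \<and> \<alpha> \<le> 1 \<and> lower_end u \<alpha> < lower_end u 0 + e \<and> upper_end u 0 - e < upper_end u \<alpha>"
    if e: "0 < e" for e
  proof -
    have near: "\<exists>\<alpha> x. 0 < \<alpha> \<and> \<alpha> \<le> 1 \<and> x \<in> level u \<alpha> \<and> dist x t < e" if "t \<in> level u 0" for t
    proof -
      obtain x where "0 < membership u x" "dist x t < e"
        using \<open>t \<in> level u 0\<close> e by (auto simp: level_def closure_approachable)
      then show ?thesis
        by (intro exI[of _ "membership u x"] exI[of _ x]) (auto simp: level_def membership_le_1)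
    qed
    have "lower_end u 0 \<in> level u 0" "upper_end u 0 \<in> level u 0"
      by (simp_all add: level_eq_interval lower_le_upper)
    then obtain \<alpha> x \<beta> y where \<alpha>: "0 < \<alpha>" "\<alpha> \<le> 1" "x \<in> level u \<alpha>" "dist x (lower_end u 0) < e"
      and \<beta>: "0 < \<beta>" "\<beta> \<le> 1" "y \<in> level u \<beta>" "dist y (upper_end u 0) < e"
      using near by meson
    have "lower_end u \<alpha> < lower_end u 0 + e" "upper_end u 0 - e < upper_end u \<beta>"
      using \<alpha> \<beta> by (auto simp: level_eq_interval dist_real_def)
    then show ?thesis
      using mono[of "min \<alpha> \<beta>" \<alpha>] mono[of "min \<alpha> \<beta>" \<beta>] \<alpha> \<beta> by (intro exI[of _ "min \<alpha> \<beta>"]) auto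
  qed
  show ?thesis
    unfolding endpoint_functions_def using left right mono lower_le_upper[of 1 u] by auto
qed

lemma endpoint_functions_add:
  assumes "endpoint_functions a b" "endpoint_functions c d"
  shows "endpoint_functions (\<lambda>\<alpha>. a \<alpha> + c \<alpha>) (\<lambda>\<alpha>. b \<alpha> + d \<alpha>)"
proof -
  note A = assms(1)[unfolded endpoint_functions_def]
  note C = assms(2)[unfolded endpoint_functions_def]
  have mono: "a \<alpha> + c \<alpha> \<le> a \<beta> + c \<beta>" "b \<beta> + d \<beta> \<le> b \<alpha> + d \<alpha>"
    if "0 \<le> \<alpha>" "\<alpha> \<le> \<beta>" "\<beta> \<le> 1" for \<alpha> \<beta> using A C that by (auto intro!: add_mono)
  have m: "a \<alpha> \<le> a \<beta>" "c \<alpha> \<le> c \<beta>" "b \<beta> \<le> b \<alpha>" "d \<beta> \<le> d \<alpha>"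
    if "0 \<le> \<alpha>" "\<alpha> \<le> \<beta>" "\<beta> \<le> 1" for \<alpha> \<beta> using A C that by auto
  have left: "\<exists>\<beta>. 0 < \<beta> \<and> \<beta> < \<alpha> \<and> a \<alpha> + c \<alpha> - e < a \<beta> + c \<beta> \<and> b \<beta> + d \<beta> < b \<alpha> + d \<alpha> + e"
    if \<alpha>: "0 < \<alpha>" "\<alpha> \<le> 1" and e: "0 < e" for \<alpha> e
  proof -
    obtain \<beta> where \<beta>: "0 < \<beta>" "\<beta> < \<alpha>" "a \<alpha> - e/2 < a \<beta>" "b \<beta> < b \<alpha> + e/2"
      using A \<alpha> e by (meson half_gt_zero)
    obtain \<gamma> where \<gamma>: "0 < \<gamma>" "\<gamma> < \<alpha>" "c \<alpha> - e/2 < c \<gamma>" "d \<gamma> < d \<alpha> + e/2"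
      using C \<alpha> e by (meson half_gt_zero)
    have "a \<beta> \<le> a (max \<beta> \<gamma>)" "c \<gamma> \<le> c (max \<beta> \<gamma>)" "b (max \<beta> \<gamma>) \<le> b \<beta>" "d (max \<beta> \<gamma>) \<le> d \<gamma>"
      using \<beta> \<gamma> \<alpha> by (auto intro!: m)
    then show ?thesis using \<beta> \<gamma> by (intro exI[of _ "max \<beta> \<gamma>"]) (auto simp del: max_less_iff_conj simp: max_def)
  qed
  have right: "\<exists>\<alpha>. 0 < \<alpha> \<and> \<alpha> \<le> 1 \<and> a \<alpha> + c \<alpha> < a 0 + c 0 + e \<and> b 0 + d 0 - e < b \<alpha> + d \<alpha>"
    if e: "0 < e" for e
  proof -
    obtain \<beta> where \<beta>: "0 < \<beta>" "\<beta> \<le> 1" "a \<beta> < a 0 + e/2" "b 0 - e/2 < b \<beta>"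
      using A e by (meson half_gt_zero)
    obtain \<gamma> where \<gamma>: "0 < \<gamma>" "\<gamma> \<le> 1" "c \<gamma> < c 0 + e/2" "d 0 - e/2 < d \<gamma>"
      using C e by (meson half_gt_zero)
    have "a (min \<beta> \<gamma>) \<le> a \<beta>" "c (min \<beta> \<gamma>) \<le> c \<gamma>" "b \<beta> \<le> b (min \<beta> \<gamma>)" "d \<gamma> \<le> d (min \<beta> \<gamma>)"
      using \<beta> \<gamma> by (auto intro!: m)
    then show ?thesis using \<beta> \<gamma> by (intro exI[of _ "min \<beta> \<gamma>"]) (auto simp: min_def)
  qed
  show ?thesis unfolding endpoint_functions_def using left right mono A C by (auto intro: add_mono)
qed

lemma endpoint_functions_scale_pos:
  assumes "endpoint_functions a b" "0 < k"
  shows "endpoint_functions (\<lambda>\<alpha>. k * a \<alpha>) (\<lambda>\<alpha>. k * b \<alpha>)"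
proof -
  note A = assms(1)[unfolded endpoint_functions_def]
  have left: "\<exists>\<beta>. 0 < \<beta> \<and> \<beta> < \<alpha> \<and> k * a \<alpha> - e < k * a \<beta> \<and> k * b \<beta> < k * b \<alpha> + e"
    if \<alpha>: "0 < \<alpha>" "\<alpha> \<le> 1" and e: "0 < e" for \<alpha> e
  proof -
    have "0 < e / k" using e assms by simp
    then obtain \<beta> where "0 < \<beta>" "\<beta> < \<alpha>" "a \<alpha> - e/k < a \<beta>" "b \<beta> < b \<alpha> + e/k"
      using A \<alpha> by meson
    then show ?thesis using assms(2) by (intro exI[of _ \<beta>]) (auto simp: field_simps)
  qed
  have right: "\<exists>\<alpha>. 0 < \<alpha> \<and> \<alpha> \<le> 1 \<and> k * a \<alpha> < k * a 0 + e \<and> k * b 0 - e < k * b \<alpha>"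
    if e: "0 < e" for e
  proof -
    have "0 < e / k" using e assms by simp
    then obtain \<beta> where "0 < \<beta>" "\<beta> \<le> 1" "a \<beta> < a 0 + e/k" "b 0 - e/k < b \<beta>"
      using A by meson
    then show ?thesis using assms(2) by (intro exI[of _ \<beta>]) (auto simp: field_simps)
  qed
  show ?thesis unfolding endpoint_functions_def using left right A assms(2) by auto
qed

lemma endpoint_functions_minus:
  assumes "endpoint_functions a b"
  shows "endpoint_functions (\<lambda>\<alpha>. - b \<alpha>) (\<lambda>\<alpha>. - a \<alpha>)"
proof -
  note A = assms[unfolded endpoint_functions_def]
  have left: "\<exists>\<beta>. 0 < \<beta> \<and> \<beta> < \<alpha> \<and> - b \<alpha> - e < - b \<beta> \<and> - a \<beta> < - a \<alpha> + e"
    if \<alpha>: "0 < \<alpha>" "\<alpha> \<le> 1" and e: "0 < e" for \<alpha> e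
  proof -
    obtain \<beta> where "0 < \<beta>" "\<beta> < \<alpha>" "a \<alpha> - e < a \<beta>" "b \<beta> < b \<alpha> + e"
      using A \<alpha> e by meson
    then show ?thesis by (intro exI[of _ \<beta>]) auto
  qed
  have right: "\<exists>\<alpha>. 0 < \<alpha> \<and> \<alpha> \<le> 1 \<and> - b \<alpha> < - b 0 + e \<and> - a 0 - e < - a \<alpha>"
    if e: "0 < e" for e
  proof -
    obtain \<beta> where "0 < \<beta>" "\<beta> \<le> 1" "a \<beta> < a 0 + e" "b 0 - e < b \<beta>"
      using A e by meson
    then show ?thesis by (intro exI[of _ \<beta>]) auto
  qed
  show ?thesis unfolding endpoint_functions_def using left right A by auto
qed

lemma endpoint_functions_zero: "endpoint_functions (\<lambda>_. 0) (\<lambda>_. 0)"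
  unfolding endpoint_functions_def by (auto intro: dense exI[of _ 1])

lemma endpoint_functions_realize:
  assumes "endpoint_functions a b"
  shows "\<exists>!w. \<forall>\<alpha>\<in>{0..1}. level w \<alpha> = {a \<alpha>..b \<alpha>}"
proof (rule ex_ex1I)
  note A = assms[unfolded endpoint_functions_def]
  have mono: "a \<alpha> \<le> a \<beta>" "b \<beta> \<le> b \<alpha>" if "0 \<le> \<alpha>" "\<alpha> \<le> \<beta>" "\<beta> \<le> 1" for \<alpha> \<beta>
    using A that by auto
  have ab: "a \<alpha> \<le> b \<alpha>" if "0 \<le> \<alpha>" "\<alpha> \<le> 1" for \<alpha>
    using mono[of \<alpha> 1] A that by linarith
  define S where "S t = insert 0 {\<alpha>. 0 < \<alpha> \<and> \<alpha> \<le> 1 \<and> a \<alpha> \<le> t \<and> t \<le> b \<alpha>}" for t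
  define w where "w t = Sup (S t)" for t
  have bdd: "bdd_above (S t)" for t by (rule bdd_aboveI[of _ 1]) (auto simp: S_def)
  have ne: "S t \<noteq> {}" for t by (simp add: S_def)
  have w0: "0 \<le> w t" for t unfolding w_def by (rule cSup_upper[OF _ bdd]) (simp add: S_def)
  have w1: "w t \<le> 1" for t unfolding w_def by (rule cSup_least[OF ne]) (auto simp: S_def)
  have cut: "\<alpha> \<le> w t \<longleftrightarrow> a \<alpha> \<le> t \<and> t \<le> b \<alpha>" if \<alpha>: "0 < \<alpha>" "\<alpha> \<le> 1" for \<alpha> t
  proof
    assume "a \<alpha> \<le> t \<and> t \<le> b \<alpha>"
    then show "\<alpha> \<le> w t" unfolding w_def using \<alpha> by (intro cSup_upper[OF _ bdd]) (simp add: S_def)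
  next
    assume le: "\<alpha> \<le> w t"
    show "a \<alpha> \<le> t \<and> t \<le> b \<alpha>"
    proof (rule ccontr)
      assume "\<not> ?thesis"
      then have "0 < max (a \<alpha> - t) (t - b \<alpha>)" by auto
      then obtain \<beta> where \<beta>: "0 < \<beta>" "\<beta> < \<alpha>" "a \<alpha> - max (a \<alpha> - t) (t - b \<alpha>) < a \<beta>"
        "b \<beta> < b \<alpha> + max (a \<alpha> - t) (t - b \<alpha>)" using A \<alpha> by meson
      then have out: "t < a \<beta> \<or> b \<beta> < t" by (auto simp: max_def split: if_splits)
      have "w t \<le> \<beta>" unfolding w_def
      proof (rule cSup_least[OF ne])
        fix \<gamma> assume \<gamma>: "\<gamma> \<in> S t"
        show "\<gamma> \<le> \<beta>"
        proof (rule ccontr)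
          assume "\<not> ?thesis"
          then have "a \<gamma> \<le> t" "t \<le> b \<gamma>" "a \<beta> \<le> a \<gamma>" "b \<gamma> \<le> b \<beta>"
            using \<gamma> \<beta> mono[of \<beta> \<gamma>] by (auto simp: S_def)
          then show False using out by linarith
        qed
      qed
      then show False using le \<beta> by linarith
    qed
  qed
  have conv: "min (w t) (w t') \<le> w (\<theta> * t + (1 - \<theta>) * t')" if \<theta>: "0 \<le> \<theta>" "\<theta> \<le> 1" for t t' \<theta>
  proof (cases "min (w t) (w t') = 0")
    case False
    define m where "m = min (w t) (w t')"
    have m: "0 < m" "m \<le> 1" using False w0[of t] w0[of t'] w1[of t] by (auto simp: m_def)
    have "m \<le> w t" "m \<le> w t'" by (simp_all add: m_def)
    then have "t \<in> {a m..b m}" "t' \<in> {a m..b m}" using cut[OF m] by simp_all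
    then have "\<theta> *\<^sub>R t + (1 - \<theta>) *\<^sub>R t' \<in> {a m..b m}"
      using \<theta> convexD[OF convex_real_interval(5)[of "a m" "b m"], of t t' \<theta> "1 - \<theta>"] by simp
    then have "m \<le> w (\<theta> * t + (1 - \<theta>) * t')" using cut[OF m] by simp
    then show ?thesis by (simp only: m_def)
  qed (use w0 in simp)
  have usc: "upper_semicontinuous w" unfolding upper_semicontinuous_def
  proof (intro allI impI)
    fix t y assume y: "w t < y"
    show "\<forall>\<^sub>F x in nhds t. w x < y"
    proof (cases "y \<le> 1")
      case True
      have y0: "0 < y" using y w0[of t] by linarith
      have "{x. y \<le> w x} = {a y..b y}" by (simp add: set_eq_iff cut[OF y0 True])
      moreover have "{x. w x < y} = - {x. y \<le> w x}" by (simp add: set_eq_iff not_le)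
      ultimately have "{x. w x < y} = - {a y..b y}" by simp
      then have "open {x. w x < y}" by (simp add: open_Compl)
      then show ?thesis using y by (auto simp: eventually_nhds)
    next
      case False
      then have "w x < y" for x using w1[of x] by linarith
      then show ?thesis by simp
    qed
  qed
  have supp: "0 < w t \<longleftrightarrow> (\<exists>\<alpha>. 0 < \<alpha> \<and> \<alpha> \<le> 1 \<and> a \<alpha> \<le> t \<and> t \<le> b \<alpha>)" for t
  proof
    assume "0 < w t"
    then show "\<exists>\<alpha>. 0 < \<alpha> \<and> \<alpha> \<le> 1 \<and> a \<alpha> \<le> t \<and> t \<le> b \<alpha>"
      using cut[of "w t" t] w1[of t] by (intro exI[of _ "w t"]) simp
  next
    assume "\<exists>\<alpha>. 0 < \<alpha> \<and> \<alpha> \<le> 1 \<and> a \<alpha> \<le> t \<and> t \<le> b \<alpha>"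
    then obtain \<alpha> where "0 < \<alpha>" "\<alpha> \<le> w t" using cut by blast
    then show "0 < w t" by linarith
  qed
  have sub: "{t. 0 < w t} \<subseteq> {a 0..b 0}"
  proof
    fix t assume "t \<in> {t. 0 < w t}"
    then obtain \<alpha> where "0 < \<alpha>" "\<alpha> \<le> 1" "a \<alpha> \<le> t" "t \<le> b \<alpha>" using supp by auto
    then show "t \<in> {a 0..b 0}" using mono[of 0 \<alpha>] by auto
  qed
  have cl: "closure {t. 0 < w t} = {a 0..b 0}"
  proof
    show "closure {t. 0 < w t} \<subseteq> {a 0..b 0}" using sub by (simp add: closure_minimal)
    show "{a 0..b 0} \<subseteq> closure {t. 0 < w t}"
    proof
      fix t assume t: "t \<in> {a 0..b 0}"
      show "t \<in> closure {t. 0 < w t}" unfolding closure_approachable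
      proof (intro allI impI)
        fix e :: real assume "0 < e"
        then obtain \<alpha> where \<alpha>: "0 < \<alpha>" "\<alpha> \<le> 1" "a \<alpha> < a 0 + e" "b 0 - e < b \<alpha>" using A by meson
        define x where "x = max (a \<alpha>) (min t (b \<alpha>))"
        have "0 < w x" unfolding supp x_def using \<alpha> ab[of \<alpha>] by (intro exI[of _ \<alpha>]) auto
        moreover have "dist x t < e"
          using \<alpha> t ab[of \<alpha>] \<open>0 < e\<close> unfolding x_def dist_real_def by (auto simp: max_def min_def)
        ultimately show "\<exists>y\<in>{t. 0 < w t}. dist y t < e" by blast
      qed
    qed
  qed
  have "1 \<le> w (a 1)" using cut[of 1] ab[of 1] by simp
  then have "w (a 1) = 1" using w1[of "a 1"] by linarith
  then have "fuzzy_number w"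
    unfolding fuzzy_number_def using w0 w1 conv usc cl by auto
  then have mw: "membership (Abs_fuzzy w) = w" by (simp add: Abs_fuzzy_inverse)
  have "level (Abs_fuzzy w) \<alpha> = {a \<alpha>..b \<alpha>}" if "\<alpha> \<in> {0..1}" for \<alpha>
  proof (cases "\<alpha> = 0")
    case True
    then show ?thesis using cl by (simp add: level_def mw)
  next
    case False
    then show ?thesis using that by (simp add: level_def mw set_eq_iff cut)
  qed
  then show "\<exists>w. \<forall>\<alpha>\<in>{0..1}. level w \<alpha> = {a \<alpha>..b \<alpha>}" by blast
next
  fix v w
  assume "\<forall>\<alpha>\<in>{0..1}. level v \<alpha> = {a \<alpha>..b \<alpha>}" "\<forall>\<alpha>\<in>{0..1}. level w \<alpha> = {a \<alpha>..b \<alpha>}"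
  then show "v = w" by (intro fuzzy_eqI_level) simp
qed

instantiation fuzzy :: "{zero, plus, scaleR}"
begin

definition zero_fuzzy :: fuzzy where
  "0 = Abs_fuzzy (\<lambda>t. if t = 0 then 1 else 0)"

definition plus_fuzzy :: "fuzzy \<Rightarrow> fuzzy \<Rightarrow> fuzzy" where
  "u + v = (THE w. \<forall>\<alpha>\<in>{0..1}.
     level w \<alpha> = {lower_end u \<alpha> + lower_end v \<alpha> .. upper_end u \<alpha> + upper_end v \<alpha>})"

definition scaleR_fuzzy :: "real \<Rightarrow> fuzzy \<Rightarrow> fuzzy" where
  "k *\<^sub>R u = (THE w. \<forall>\<alpha>\<in>{0..1}.
     level w \<alpha> = (if 0 \<le> k then {k * lower_end u \<alpha> .. k * upper_end u \<alpha>}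
                  else {k * upper_end u \<alpha> .. k * lower_end u \<alpha>}))"

instance ..

end

lemma membership_zero: "membership 0 t = (if t = 0 then 1 else 0)"
  by (simp add: zero_fuzzy_def Abs_fuzzy_inverse fuzzy_number_indicator)

lemma level_zero: "\<alpha> \<in> {0..1} \<Longrightarrow> level 0 \<alpha> = {0}"
  by (auto simp: level_def membership_zero split: if_splits)

lemma level_plus:
  assumes "\<alpha> \<in> {0..1}"
  shows "level (u + v) \<alpha> = {lower_end u \<alpha> + lower_end v \<alpha> .. upper_end u \<alpha> + upper_end v \<alpha>}"
  unfolding plus_fuzzy_def
  by (rule bspec[OF theI'[OF endpoint_functions_realize[OF endpoint_functions_add[OF
      endpoint_functions_ends[of u] endpoint_functions_ends[of v]]]] assms])

lemma level_scaleR: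
  assumes "\<alpha> \<in> {0..1}"
  shows "level (k *\<^sub>R u) \<alpha> = (if 0 \<le> k then {k * lower_end u \<alpha> .. k * upper_end u \<alpha>}
                  else {k * upper_end u \<alpha> .. k * lower_end u \<alpha>})"
proof -
  have "endpoint_functions (\<lambda>\<alpha>. if 0 \<le> k then k * lower_end u \<alpha> else k * upper_end u \<alpha>)
          (\<lambda>\<alpha>. if 0 \<le> k then k * upper_end u \<alpha> else k * lower_end u \<alpha>)"
  proof (cases k "0 :: real" rule: linorder_cases)
    case less
    then have "endpoint_functions (\<lambda>\<alpha>. - (- k * upper_end u \<alpha>)) (\<lambda>\<alpha>. - (- k * lower_end u \<alpha>))"
      by (intro endpoint_functions_minus endpoint_functions_scale_pos endpoint_functions_ends) simp
    then show ?thesis using less by simp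
  next
    case equal
    then show ?thesis using endpoint_functions_zero by simp
  next
    case greater
    then show ?thesis
      using endpoint_functions_scale_pos[OF endpoint_functions_ends[of u]] by simp
  qed
  from theI'[OF endpoint_functions_realize[OF this]] assms
  show ?thesis unfolding scaleR_fuzzy_def by (cases "0 \<le> k") simp_all
qed

lemma lower_end_eqI: "level w \<alpha> = {x..y} \<Longrightarrow> x \<le> y \<Longrightarrow> lower_end w \<alpha> = x"
  by (simp add: lower_end_def)

lemma upper_end_eqI: "level w \<alpha> = {x..y} \<Longrightarrow> x \<le> y \<Longrightarrow> upper_end w \<alpha> = y"
  by (simp add: upper_end_def)

lemma ends_zero:
  assumes "\<alpha> \<in> {0..1}" shows "lower_end 0 \<alpha> = 0" "upper_end 0 \<alpha> = 0"
  using level_zero[OF assms] by (simp_all add: lower_end_def upper_end_def)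

lemma ends_plus:
  assumes "\<alpha> \<in> {0..1}"
  shows "lower_end (u + v) \<alpha> = lower_end u \<alpha> + lower_end v \<alpha>"
    and "upper_end (u + v) \<alpha> = upper_end u \<alpha> + upper_end v \<alpha>"
  using lower_end_eqI[OF level_plus[OF assms]] upper_end_eqI[OF level_plus[OF assms]]
    add_mono[OF lower_le_upper[OF assms, of u] lower_le_upper[OF assms, of v]] by simp_all

lemma ends_scaleR:
  assumes "\<alpha> \<in> {0..1}"
  shows "lower_end (k *\<^sub>R u) \<alpha> = (if 0 \<le> k then k * lower_end u \<alpha> else k * upper_end u \<alpha>)"
    and "upper_end (k *\<^sub>R u) \<alpha> = (if 0 \<le> k then k * upper_end u \<alpha> else k * lower_end u \<alpha>)"
  using level_scaleR[OF assms, of k u] lower_le_upper[OF assms, of u]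
  by (auto simp: lower_end_def upper_end_def mult_left_mono mult_left_mono_neg)

instance fuzzy :: comm_monoid_add
proof
  fix u v w :: fuzzy
  show "u + v + w = u + (v + w)" by (rule fuzzy_eqI) (simp_all add: ends_plus)
  show "u + v = v + u" by (rule fuzzy_eqI) (simp_all add: ends_plus)
  show "0 + u = u" by (rule fuzzy_eqI) (simp_all add: ends_plus ends_zero)
qed

definition fuzzy_dist :: "fuzzy \<Rightarrow> fuzzy \<Rightarrow> real" where
  "fuzzy_dist u v = (SUP \<alpha>\<in>{0..1}.
     max \<bar>lower_end u \<alpha> - lower_end v \<alpha>\<bar> \<bar>upper_end u \<alpha> - upper_end v \<alpha>\<bar>)"

lemma fuzzy_dist_bdd:
  "bdd_above ((\<lambda>\<alpha>. max \<bar>lower_end u \<alpha> - lower_end v \<alpha>\<bar> \<bar>upper_end u \<alpha> - upper_end v \<alpha>\<bar>) ` {0..1})"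
proof -
  define M where "M w = \<bar>lower_end w 0\<bar> + \<bar>upper_end w 0\<bar>" for w
  have M: "\<bar>lower_end w \<alpha>\<bar> \<le> M w" "\<bar>upper_end w \<alpha>\<bar> \<le> M w" if "\<alpha> \<in> {0..1}" for w \<alpha>
    using ends_antimono[of 0 \<alpha> w] lower_le_upper[OF that, of w] that by (auto simp: M_def)
  show ?thesis
  proof (rule bdd_aboveI2[of _ _ "M u + M v"])
    fix \<alpha> :: real assume "\<alpha> \<in> {0..1}"
    then show "max \<bar>lower_end u \<alpha> - lower_end v \<alpha>\<bar> \<bar>upper_end u \<alpha> - upper_end v \<alpha>\<bar> \<le> M u + M v"
      using M[of \<alpha> u] M[of \<alpha> v] by (simp add: abs_le_iff)
  qed
qed

lemma ends_le_fuzzy_dist: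
  assumes "\<alpha> \<in> {0..1}"
  shows "\<bar>lower_end u \<alpha> - lower_end v \<alpha>\<bar> \<le> fuzzy_dist u v" "\<bar>upper_end u \<alpha> - upper_end v \<alpha>\<bar> \<le> fuzzy_dist u v"
  using cSUP_upper[OF assms fuzzy_dist_bdd[of u v]] by (simp_all add: fuzzy_dist_def)

lemma fuzzy_dist_le:
  assumes "\<And>\<alpha>. \<alpha> \<in> {0..1} \<Longrightarrow> \<bar>lower_end u \<alpha> - lower_end v \<alpha>\<bar> \<le> c"
    and "\<And>\<alpha>. \<alpha> \<in> {0..1} \<Longrightarrow> \<bar>upper_end u \<alpha> - upper_end v \<alpha>\<bar> \<le> c"
  shows "fuzzy_dist u v \<le> c"
  unfolding fuzzy_dist_def using assms by (intro cSUP_least) auto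

instantiation fuzzy :: metric_space
begin

definition dist_fuzzy :: "fuzzy \<Rightarrow> fuzzy \<Rightarrow> real" where
  "dist_fuzzy = fuzzy_dist"

definition uniformity_fuzzy :: "(fuzzy \<times> fuzzy) filter" where
  "uniformity_fuzzy = (INF e\<in>{0<..}. principal {(x, y). dist x y < e})"

definition open_fuzzy :: "fuzzy set \<Rightarrow> bool" where
  "open_fuzzy U \<longleftrightarrow> (\<forall>x\<in>U. \<forall>\<^sub>F (x', y) in uniformity. x' = x \<longrightarrow> y \<in> U)"

instance
proof
  fix u v w :: fuzzy
  show "dist u v = 0 \<longleftrightarrow> u = v"
  proof
    assume "dist u v = 0"
    then show "u = v" unfolding dist_fuzzy_def using ends_le_fuzzy_dist[of _ u v] by (intro fuzzy_eqI) auto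
  next
    assume "u = v"
    then show "dist u v = 0" by (simp add: dist_fuzzy_def fuzzy_dist_def)
  qed
  show "dist u v \<le> dist u w + dist v w"
  unfolding dist_fuzzy_def
  proof (rule fuzzy_dist_le)
    fix \<alpha> :: real assume "\<alpha> \<in> {0..1}"
    note E = ends_le_fuzzy_dist[OF this, of u w] ends_le_fuzzy_dist[OF this, of v w]
    show "\<bar>lower_end u \<alpha> - lower_end v \<alpha>\<bar> \<le> fuzzy_dist u w + fuzzy_dist v w" using E by linarith
    show "\<bar>upper_end u \<alpha> - upper_end v \<alpha>\<bar> \<le> fuzzy_dist u w + fuzzy_dist v w" using E by linarith
  qed
qed (simp_all add: uniformity_fuzzy_def open_fuzzy_def)

end

definition factorial_series_term :: "(nat \<Rightarrow> real) \<Rightarrow> (nat \<Rightarrow> fuzzy) \<Rightarrow> real \<Rightarrow> nat \<Rightarrow> fuzzy" where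
  "factorial_series_term l u s n = ((\<Prod>i\<le>n. l i) / (\<Prod>i\<le>n. s + l i)) *\<^sub>R u n"

definition factorial_series_summable_to :: "(nat \<Rightarrow> real) \<Rightarrow> (nat \<Rightarrow> fuzzy) \<Rightarrow> fuzzy \<Rightarrow> bool" where
  "factorial_series_summable_to l u \<mu> \<longleftrightarrow>
     (\<forall>s>0. summable (factorial_series_term l u s)) \<and>
     ((\<lambda>s. \<Sum>n. factorial_series_term l u s n) \<longlongrightarrow> \<mu>) (at_right 0)"

end

theory Submission
  imports Defs
begin

text \<open>
  Write \<open>H N = (\<Sum>r\<le>N. 1 / l r)\<close> and let \<open>q s n\<close> be the weight of \<open>u n\<close> in the factorial series.
  The partial sum up to \<open>N\<close> is compared with the factorial series at \<open>s = 1 / H N\<close>. Bernoulli's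
  inequality gives \<open>1 - q s n \<le> s * H n\<close>, so by the Tauberian condition the head of the difference is
  at most a weighted mean of a null sequence, with the non-summable weights \<open>1 / l n\<close>. The tail is
  controlled by the telescoping identity \<open>q s n / l n = (q s (n - 1) - q s n) / s\<close>.
\<close>

section \<open>Metric estimates for sums and multiples of fuzzy numbers\<close>

text \<open>Endpoints add at each level. As fuzzy numbers have no subtraction, this takes the place
  of norm estimates for differences.\<close>

lemma dist_fuzzy_add_le:
  fixes u v u' v' :: fuzzy
  shows "dist (u + v) (u' + v') \<le> dist u u' + dist v v'"
  unfolding dist_fuzzy_def
proof (rule fuzzy_dist_le)
  fix \<alpha> :: real assume \<alpha>: "\<alpha> \<in> {0..1}"
  note E = ends_le_fuzzy_dist[OF \<alpha>, of u u'] ends_le_fuzzy_dist[OF \<alpha>, of v v']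
  show "\<bar>lower_end (u + v) \<alpha> - lower_end (u' + v') \<alpha>\<bar> \<le> fuzzy_dist u u' + fuzzy_dist v v'"
    using E by (simp add: ends_plus[OF \<alpha>])
  show "\<bar>upper_end (u + v) \<alpha> - upper_end (u' + v') \<alpha>\<bar> \<le> fuzzy_dist u u' + fuzzy_dist v v'"
    using E by (simp add: ends_plus[OF \<alpha>])
qed

lemma dist_fuzzy_sum_le:
  fixes f g :: "'a \<Rightarrow> fuzzy"
  shows "dist (\<Sum>i\<in>A. f i) (\<Sum>i\<in>A. g i) \<le> (\<Sum>i\<in>A. dist (f i) (g i))"
proof (induction A rule: infinite_finite_induct)
  case (insert x A)
  then show ?case
    using dist_fuzzy_add_le[of "f x" "sum f A" "g x" "sum g A"] by simp
qed auto

lemma fuzzy_scaleR_one: "1 *\<^sub>R u = (u :: fuzzy)"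
  by (rule fuzzy_eqI) (simp_all add: ends_scaleR)

lemma fuzzy_scaleR_zero: "0 *\<^sub>R u = (0 :: fuzzy)"
  by (rule fuzzy_eqI) (simp_all add: ends_scaleR ends_zero)

text \<open>Nonnegative scalars do not swap endpoints, so at each level the difference factors as
  \<open>a - b\<close> times an endpoint of \<open>u\<close>.\<close>

lemma dist_fuzzy_scaleR_le:
  fixes u :: fuzzy
  assumes "0 \<le> a" "0 \<le> b"
  shows "dist (a *\<^sub>R u) (b *\<^sub>R u) \<le> \<bar>a - b\<bar> * dist u 0"
  unfolding dist_fuzzy_def
proof (rule fuzzy_dist_le)
  fix \<alpha> :: real assume \<alpha>: "\<alpha> \<in> {0..1}"
  note E = ends_le_fuzzy_dist[OF \<alpha>, of u 0, unfolded ends_zero[OF \<alpha>]]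
  have "\<bar>lower_end (a *\<^sub>R u) \<alpha> - lower_end (b *\<^sub>R u) \<alpha>\<bar> = \<bar>a - b\<bar> * \<bar>lower_end u \<alpha>\<bar>"
    using assms by (simp add: ends_scaleR[OF \<alpha>] flip: abs_mult left_diff_distrib)
  also have "\<dots> \<le> \<bar>a - b\<bar> * fuzzy_dist u 0"
    using E by (intro mult_left_mono) auto
  finally show "\<bar>lower_end (a *\<^sub>R u) \<alpha> - lower_end (b *\<^sub>R u) \<alpha>\<bar> \<le> \<bar>a - b\<bar> * fuzzy_dist u 0" .
  have "\<bar>upper_end (a *\<^sub>R u) \<alpha> - upper_end (b *\<^sub>R u) \<alpha>\<bar> = \<bar>a - b\<bar> * \<bar>upper_end u \<alpha>\<bar>"
    using assms by (simp add: ends_scaleR[OF \<alpha>] flip: abs_mult left_diff_distrib)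
  also have "\<dots> \<le> \<bar>a - b\<bar> * fuzzy_dist u 0"
    using E by (intro mult_left_mono) auto
  finally show "\<bar>upper_end (a *\<^sub>R u) \<alpha> - upper_end (b *\<^sub>R u) \<alpha>\<bar> \<le> \<bar>a - b\<bar> * fuzzy_dist u 0" .
qed

section \<open>The weights of the factorial series\<close>

text \<open>The weight \<open>q s n\<close> from above, split off as a real number; for positive
  \<open>l i\<close> it is the product of \<open>1 / (1 + s / l i)\<close> over i up to n.\<close>

definition factorial_weight :: "(nat \<Rightarrow> real) \<Rightarrow> real \<Rightarrow> nat \<Rightarrow> real" where
  "factorial_weight l s n = (\<Prod>i\<le>n. l i) / (\<Prod>i\<le>n. s + l i)"

lemma factorial_weight_bounds:
  assumes pos: "\<And>n. 0 < l n" and "0 < s"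
  shows "0 < factorial_weight l s n" "factorial_weight l s n \<le> 1"
proof -
  have "0 < (\<Prod>i\<le>n. l i)" "0 < (\<Prod>i\<le>n. s + l i)"
    using pos \<open>0 < s\<close> by (simp_all add: prod_pos add_pos_pos)
  moreover have "(\<Prod>i\<le>n. l i) \<le> (\<Prod>i\<le>n. s + l i)"
    using pos \<open>0 < s\<close> by (intro prod_mono) (simp add: less_imp_le)
  ultimately show "0 < factorial_weight l s n" "factorial_weight l s n \<le> 1"
    by (simp_all add: factorial_weight_def)
qed

text \<open>The old weight is the new one times \<open>1 + s / l (Suc n)\<close>.\<close>

lemma factorial_weight_Suc_diff:
  assumes pos: "\<And>n. 0 < l n" and "0 < s"
  shows "factorial_weight l s n - factorial_weight l s (Suc n) =
    s * (factorial_weight l s (Suc n) / l (Suc n))"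
proof -
  have "factorial_weight l s (Suc n) = factorial_weight l s n * (l (Suc n) / (s + l (Suc n)))"
    by (simp add: factorial_weight_def)
  moreover have "0 < s + l (Suc n)"
    using pos \<open>0 < s\<close> by (simp add: add_pos_pos)
  ultimately show ?thesis
    using pos[of "Suc n"] by (simp add: field_simps)
qed

text \<open>Bernoulli's inequality in additive form: each further factor lowers the weight by at
  most \<open>s / l (Suc n)\<close>, because the weight itself is at most 1.\<close>

lemma one_minus_factorial_weight_le:
  assumes pos: "\<And>n. 0 < l n" and "0 < s"
  shows "1 - factorial_weight l s n \<le> s * (\<Sum>r\<le>n. 1 / l r)"
proof (induction n)
  case 0
  have "s * l 0 \<le> s * (s + l 0)"
    using \<open>0 < s\<close> by simp
  then show ?case
    using pos[of 0] \<open>0 < s\<close> by (simp add: factorial_weight_def field_simps)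
next
  case (Suc n)
  have "factorial_weight l s n - factorial_weight l s (Suc n) \<le> s * (1 / l (Suc n))"
    unfolding factorial_weight_Suc_diff[of l s n, OF assms]
    using pos[of "Suc n"] \<open>0 < s\<close> factorial_weight_bounds(2)[of l s "Suc n", OF assms]
    by (intro mult_left_mono divide_right_mono) auto
  then show ?case
    using Suc by (simp add: distrib_left)
qed

text \<open>The sum telescopes to a difference of two weights in \<open>(0, 1]\<close>. The bound is
  uniform in \<open>k\<close>, so it survives the passage to an infinite tail.\<close>

lemma sum_factorial_weight_le:
  assumes pos: "\<And>n. 0 < l n" and "0 < s"
  shows "s * (\<Sum>n\<in>{N<..N + k}. factorial_weight l s n / l n) \<le> 1"
proof -
  have "s * (\<Sum>n\<in>{N<..N + k}. factorial_weight l s n / l n)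
      = factorial_weight l s N - factorial_weight l s (N + k)"
  proof (induction k)
    case (Suc k)
    have "{N<..N + Suc k} = insert (Suc (N + k)) {N<..N + k}" by auto
    then show ?case
      using Suc factorial_weight_Suc_diff[of l s "N + k", OF assms] by (simp add: distrib_left)
  qed simp
  then show ?thesis
    using factorial_weight_bounds[of l s N, OF assms] factorial_weight_bounds[of l s "N + k", OF assms] by simp
qed

section \<open>Partial sums against the factorial series\<close>

text \<open>The two summands are the head error and the tail error, joined at the partial sum of the
  factorial series up to \<open>N\<close>. Here \<open>s\<close> and \<open>N\<close> are still
  independent.\<close>

lemma dist_sum_factorial_series_le:
  fixes u :: "nat \<Rightarrow> fuzzy"
  assumes pos: "\<And>n. 0 < l n" and "0 < s"
    and sm: "summable (factorial_series_term l u s)"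
    and tail: "\<And>n. N \<le> n \<Longrightarrow> l n * dist (u n) 0 \<le> c"
  shows "dist (\<Sum>n\<le>N. u n) (\<Sum>n. factorial_series_term l u s n)
    \<le> s * (\<Sum>n\<le>N. (\<Sum>r\<le>n. 1 / l r) * dist (u n) 0) + c / s"
proof -
  define q where "q = factorial_weight l s"
  define t where "t = factorial_series_term l u s"
  have t: "t n = q n *\<^sub>R u n" for n
    by (simp add: t_def q_def factorial_series_term_def factorial_weight_def)
  have q: "0 < q n" "q n \<le> 1" for n
    unfolding q_def using factorial_weight_bounds[of l s n, OF pos \<open>0 < s\<close>] by auto
  \<comment> \<open>Nonnegativity of \<open>c\<close> comes from the tail bound at
    \<open>n = N\<close>; it lets the telescoped sum be multiplied by \<open>c / s\<close>.\<close>
  have "0 \<le> l N * dist (u N) 0"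
    using pos[of N] by simp
  with tail[of N] have "0 \<le> c" by simp
  have "dist (u n) (t n) \<le> s * ((\<Sum>r\<le>n. 1 / l r) * dist (u n) 0)" for n
  proof -
    have "dist (u n) (t n) \<le> (1 - q n) * dist (u n) 0"
      using dist_fuzzy_scaleR_le[of 1 "q n" "u n"] q[of n] by (simp add: t fuzzy_scaleR_one)
    also have "\<dots> \<le> (s * (\<Sum>r\<le>n. 1 / l r)) * dist (u n) 0"
      unfolding q_def by (intro mult_right_mono one_minus_factorial_weight_le pos \<open>0 < s\<close>) simp
    finally show ?thesis by (simp add: mult.assoc)
  qed
  then have head: "dist (sum u {..N}) (sum t {..N})
      \<le> s * (\<Sum>n\<le>N. (\<Sum>r\<le>n. 1 / l r) * dist (u n) 0)"
    by (auto simp: sum_distrib_left intro: order.trans[OF dist_fuzzy_sum_le] sum_mono)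
  have T: "dist (sum t {..N}) (sum t {..N + k}) \<le> c / s" for k
  proof -
    have "{..N + k} = {..N} \<union> {N<..N + k}" by auto
    then have "sum t {..N + k} = sum t {..N} + sum t {N<..N + k}"
      by (simp add: sum.union_disjoint disjoint_iff)
    \<comment> \<open>The common summand is removed by subadditivity and
      \<open>dist x x = 0\<close>, in place of a subtraction.\<close>
    then have "dist (sum t {..N}) (sum t {..N + k}) \<le> dist (sum t {N<..N + k}) 0"
      using dist_fuzzy_add_le[of "sum t {..N}" 0 "sum t {..N}" "sum t {N<..N + k}"]
      by (simp add: dist_commute)
    also have "\<dots> \<le> (\<Sum>n\<in>{N<..N + k}. dist (t n) 0)"
      using dist_fuzzy_sum_le[of t "{N<..N + k}" "\<lambda>_. 0"] by simp
    also have "\<dots> \<le> (\<Sum>n\<in>{N<..N + k}. c * (q n / l n))"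
    proof (rule sum_mono)
      fix n assume n: "n \<in> {N<..N + k}"
      have "dist (t n) 0 \<le> q n * dist (u n) 0"
        using dist_fuzzy_scaleR_le[of "q n" 0 "u n"] q(1)[of n] by (simp add: t fuzzy_scaleR_zero)
      also have "\<dots> = (l n * dist (u n) 0) * (q n / l n)"
        using pos[of n] by simp
      also have "\<dots> \<le> c * (q n / l n)"
        using tail[of n] n q(1)[of n] pos[of n] by (intro mult_right_mono) auto
      finally show "dist (t n) 0 \<le> c * (q n / l n)" .
    qed
    also have "\<dots> = c / s * (s * (\<Sum>n\<in>{N<..N + k}. q n / l n))"
      using \<open>0 < s\<close> by (simp add: sum_distrib_left)
    also have "\<dots> \<le> c / s * 1"
      unfolding q_def using \<open>0 \<le> c\<close> \<open>0 < s\<close> pos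
      by (intro mult_left_mono sum_factorial_weight_le) auto
    finally show ?thesis by simp
  qed
  \<comment> \<open>Continuity of \<open>dist\<close> carries the bound, uniform in
    \<open>k\<close>, over to the full series.\<close>
  have "(\<lambda>n. sum t {..n}) \<longlonglongrightarrow> suminf t"
    using summable_sums[OF sm] by (simp add: t_def sums_def_le)
  then have "(\<lambda>n. sum t {..n + N}) \<longlonglongrightarrow> suminf t"
    by (rule LIMSEQ_ignore_initial_segment)
  then have "(\<lambda>n. dist (sum t {..N}) (sum t {..n + N})) \<longlonglongrightarrow> dist (sum t {..N}) (suminf t)"
    by (intro tendsto_dist tendsto_const)
  then have "dist (sum t {..N}) (suminf t) \<le> c / s"
    by (rule LIMSEQ_le_const2) (use T in \<open>auto simp: add.commute\<close>)
  then show ?thesis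
    using head dist_triangle[of "sum u {..N}" "suminf t" "sum t {..N}"] unfolding t_def by linarith
qed

section \<open>Weighted means of null sequences\<close>

text \<open>Toeplitz argument: from some \<open>M\<close> on the terms cost at most
  \<open>\<epsilon> / 2\<close> times the total weight, and the fixed contribution \<open>C\<close>
  of the earlier terms is absorbed by the diverging total weight.\<close>

lemma weighted_mean_eventually_le:
  fixes a e :: "nat \<Rightarrow> real"
  assumes a: "\<And>n. 0 < a n" and div: "filterlim (\<lambda>n. \<Sum>r\<le>n. a r) at_top sequentially"
    and e: "\<And>n. 0 \<le> e n" "e \<longlonglongrightarrow> 0" and "0 < \<epsilon>"
  shows "\<forall>\<^sub>F N in sequentially. (\<Sum>n\<le>N. a n * e n) \<le> \<epsilon> * (\<Sum>n\<le>N. a n)"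
proof -
  have "\<forall>\<^sub>F n in sequentially. e n < \<epsilon> / 2"
    using order_tendstoD(2)[OF e(2), of "\<epsilon> / 2"] \<open>0 < \<epsilon>\<close> by simp
  then obtain M where M: "\<And>n. n \<ge> M \<Longrightarrow> e n < \<epsilon> / 2"
    by (auto simp: eventually_sequentially)
  define C where "C = (\<Sum>n<M. a n * e n)"
  have "\<forall>\<^sub>F N in sequentially. 2 * C / \<epsilon> \<le> (\<Sum>n\<le>N. a n)"
    using div by (simp add: filterlim_at_top)
  then show ?thesis
  proof eventually_elim
    case (elim N)
    \<comment> \<open>The \<open>if\<close> isolates the terms before \<open>M\<close> and covers
      \<open>N < M\<close> as well; by nonnegativity they sum to at most \<open>C\<close>.\<close>
    have "(\<Sum>n\<le>N. a n * e n) \<le> (\<Sum>n\<le>N. (if n < M then a n * e n else 0) + \<epsilon> / 2 * a n)"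
    proof (rule sum_mono)
      fix n
      show "a n * e n \<le> (if n < M then a n * e n else 0) + \<epsilon> / 2 * a n"
        using M[of n] a[of n] \<open>0 < \<epsilon>\<close> mult_left_mono[of "e n" "\<epsilon> / 2" "a n"] by (auto simp: mult.commute)
    qed
    also have "\<dots> = (\<Sum>n\<in>{..N} \<inter> {..<M}. a n * e n) + \<epsilon> / 2 * (\<Sum>n\<le>N. a n)"
      by (simp only: sum.distrib sum.inter_restrict finite_atMost sum_distrib_left lessThan_iff)
    also have "(\<Sum>n\<in>{..N} \<inter> {..<M}. a n * e n) \<le> C"
      unfolding C_def using a e(1) by (intro sum_mono2) (auto simp: less_imp_le)
    also have "C \<le> \<epsilon> / 2 * (\<Sum>n\<le>N. a n)"
      using elim \<open>0 < \<epsilon>\<close> by (simp add: field_simps)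
    finally show ?case by simp
  qed
qed

section \<open>Coupling \<open>s = 1 / H N\<close> and passage to the limit\<close>

theorem theorem3p7:
  fixes l :: "nat \<Rightarrow> real" and u :: "nat \<Rightarrow> fuzzy" and \<mu> :: fuzzy
  assumes "0 < l 0" and "strict_mono l" and "filterlim l at_top sequentially"
    and "\<not> summable (\<lambda>n. 1 / l n)"
    and "factorial_series_summable_to l u \<mu>"
    and "(\<lambda>n. l n * (\<Sum>r\<le>n. 1 / l r) * dist (u n) 0) \<in> o(\<lambda>_. 1)"
  shows "u sums \<mu>"
proof -
  have pos: "0 < l n" for n
    using assms(1) strict_mono_mono[OF assms(2), THEN monoD, of 0 n] by simp
  define H where "H = (\<lambda>n. \<Sum>r\<le>n. 1 / l r)"
  have "0 < H n" for n
    unfolding H_def using pos by (intro sum_pos) auto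
  have "mono H"
    unfolding H_def using pos by (intro monoI sum_mono2) (auto simp: less_imp_le)
  define e where "e = (\<lambda>n. l n * H n * dist (u n) 0)"
  have e0: "0 \<le> e n" for n
    using pos[of n] \<open>0 < H n\<close> by (simp add: e_def)
  have e: "e \<longlonglongrightarrow> 0"
    using smalloD_tendsto[OF assms(6)] by (simp add: e_def H_def)
  \<comment> \<open>Otherwise the monotone \<open>H\<close> would be bounded, and nonnegative terms
    with bounded partial sums are summable.\<close>
  have H: "filterlim H at_top sequentially"
  proof (rule ccontr)
    assume "\<not> filterlim H at_top sequentially"
    then obtain Z where "\<exists>\<^sub>F n in sequentially. H n < Z"
      by (auto simp: filterlim_at_top not_eventually not_le)
    then have "H n \<le> Z" for n
      using monoD[OF \<open>mono H\<close>] unfolding frequently_sequentially by (meson less_imp_le order.trans)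
    then have "summable (\<lambda>n. 1 / l n)"
      using pos by (intro bounded_imp_summable[of _ Z]) (auto simp: H_def less_imp_le)
    with assms(4) show False by simp
  qed
  define f where "f = (\<lambda>s. \<Sum>n. factorial_series_term l u s n)"
  have sm: "summable (factorial_series_term l u s)" if "0 < s" for s
    using assms(5) that by (simp add: factorial_series_summable_to_def)
  have "filterlim (\<lambda>n. 1 / H n) (at_right 0) sequentially"
    using filterlim_compose[OF filterlim_inverse_at_right_top H] by (simp add: inverse_eq_divide)
  then have f: "(\<lambda>n. f (1 / H n)) \<longlonglongrightarrow> \<mu>"
    using assms(5) filterlim_compose[of f "nhds \<mu>" "at_right 0"]
    unfolding f_def factorial_series_summable_to_def by blast
  have "(\<lambda>n. dist (sum u {..n}) (f (1 / H n))) \<longlonglongrightarrow> 0"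
  proof (rule LIMSEQ_I)
    fix r :: real assume "0 < r"
    \<comment> \<open>Head and tail will each contribute at most \<open>r / 3\<close>, which leaves
      strict slack below \<open>r\<close>.\<close>
    then have "0 < r / 3" by simp
    obtain M where M: "\<And>n. n \<ge> M \<Longrightarrow> e n < r / 3"
      using order_tendstoD(2)[OF e \<open>0 < r / 3\<close>] by (auto simp: eventually_sequentially)
    have "\<forall>\<^sub>F N in sequentially. (\<Sum>n\<le>N. 1 / l n * e n) \<le> r / 3 * H N"
      unfolding H_def using pos H e0 e \<open>0 < r / 3\<close>
      by (intro weighted_mean_eventually_le) (auto simp: H_def)
    then obtain K where K: "\<And>N. N \<ge> K \<Longrightarrow> (\<Sum>n\<le>N. 1 / l n * e n) \<le> r / 3 * H N"
      by (auto simp: eventually_sequentially)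
    have "dist (sum u {..N}) (f (1 / H N)) < r" if N: "N \<ge> max M K" for N
    proof -
      \<comment> \<open>The tail constant \<open>c\<close>, chosen so that
        \<open>c / s = r / 3\<close> for \<open>s = 1 / H N\<close>; it follows from the bound on
        \<open>e n\<close> because \<open>H N \<le> H n\<close>.\<close>
      have "l n * dist (u n) 0 \<le> r / 3 / H N" if "n \<ge> N" for n
      proof -
        have "l n * dist (u n) 0 * H N \<le> l n * dist (u n) 0 * H n"
          using pos[of n] monoD[OF \<open>mono H\<close> that] by (intro mult_left_mono) auto
        also have "\<dots> \<le> r / 3"
          using M[of n] N that by (simp add: e_def mult_ac)
        finally show ?thesis
          using \<open>0 < H N\<close> by (simp add: pos_le_divide_eq)
      qed
      then have "dist (sum u {..N}) (f (1 / H N))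
          \<le> 1 / H N * (\<Sum>n\<le>N. H n * dist (u n) 0) + r / 3 / H N / (1 / H N)"
        unfolding f_def H_def using pos sm \<open>0 < H N\<close>
        by (intro dist_sum_factorial_series_le) (auto simp: H_def)
      \<comment> \<open>This makes the head the mean of \<open>e\<close> with weights
        \<open>1 / l n\<close>, whose total is \<open>H N\<close>.\<close>
      also have "(\<Sum>n\<le>N. H n * dist (u n) 0) = (\<Sum>n\<le>N. 1 / l n * e n)"
        using pos by (intro sum.cong) (auto simp: e_def less_imp_neq[symmetric])
      also have "1 / H N * (\<Sum>n\<le>N. 1 / l n * e n) \<le> 1 / H N * (r / 3 * H N)"
        using K[of N] N \<open>0 < H N\<close> by (intro mult_left_mono) auto
      finally show ?thesis
        using \<open>0 < H N\<close> \<open>0 < r\<close> by simp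
    qed
    then show "\<exists>no. \<forall>n\<ge>no. norm (dist (sum u {..n}) (f (1 / H n)) - 0) < r"
      by (intro exI[of _ "max M K"]) simp
  qed
  then have "(\<lambda>n. dist (sum u {..n}) (f (1 / H n)) + dist (f (1 / H n)) \<mu>) \<longlonglongrightarrow> 0"
    using tendsto_add[OF _ f[THEN tendsto_dist_iff[THEN iffD1]]] by fastforce
  then have "(\<lambda>n. dist (sum u {..n}) \<mu>) \<longlonglongrightarrow> 0"
    by (rule tendsto_sandwich[OF _ _ tendsto_const, rotated 2]) (auto simp: dist_triangle)
  then show ?thesis
    unfolding sums_def_le by (rule tendsto_dist_iff[THEN iffD2])
qed

end
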